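(* Let $A\in\mathbb{R}^{n\times n}$, $x_0=0$, $x_{t+1}=Ax_t+w_t$ with $w_t\sim\mathcal N(0,I_n)$ i.i.d., $X_-=[x_0,\dots,x_{N-1}]$, $X_+=[x_1,\dots,x_N]$, assume $X_-X_-^*$ is invertible, and let $\hat A=X_+X_-^*(X_-X_-^* )^{-1}$ be the ordinary least squares estimator. For $k\in\{1,\dots,n\}$ let $c_k:=X_-^*(X_-X_-^* )^{-1}e_k\in\mathbb{C}^N$. Then $$\|A-\hat A\|_F=\sqrt{\sum_{j,k=1}^n\Big|\sum_{i=1}^{N}\langle w_{i-1},e_j\rangle\,\langle c_k,\hat e_i\rangle\Big|^2},$$ and for each $k\in\{1,\dots,n\}$ the vector $c_k$ satisfies, for every $j\in\{1,\dots,n\}$, $$\sum_{i=1}^{N}\Big[\sum_{t=1}^{i-1}\langle A^{i-1-t}w_{t-1},e_j\rangle\Big]\langle c_k,\hat e_i\rangle=\delta_j(k).$$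
   Context: $[e_j]_{j=1}^n$ and $[\hat e_i]_{i=1}^N$ are the canonical bases of $\mathbb{C}^n$ and $\mathbb{C}^N$; $\|\cdot\|_F$ is the Frobenius norm; $\delta_j(k)=1$ if $j=k$ and $0$ otherwise. $\hat A$ minimizes $\sum_{t=0}^{N-1}\|x_{t+1}-Bx_t\|^2$ over $B\in\mathbb{R}^{n\times n}$. *)

theory Defs
  imports
    "HOL-Probability.Probability"
    "Jordan_Normal_Form.Schur_Decomposition"
begin

unbundle no vec_syntax

text \<open>
  Vectors and matrices are those of \<open>Jordan_Normal_Form\<close>, so that the dimensions \<open>n\<close> and \<open>N\<close> are
  natural numbers. That vector type carries no measurable structure; the Borel sigma-algebra of
  \<open>n\<close>-dimensional real space is the one transported from the product space along the coordinates,
  and the standard Gaussian law is the transported product of \<open>n\<close> one-dimensional standard normal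
  laws.
\<close>

definition borel_vec :: "nat \<Rightarrow> real vec measure" where
  "borel_vec n = vimage_algebra (carrier_vec n) (\<lambda>v. \<lambda>i\<in>{..<n}. v $ i) (PiM {..<n} (\<lambda>_. borel))"

definition std_gaussian_vec :: "nat \<Rightarrow> real vec measure" where
  "std_gaussian_vec n =
     distr (PiM {..<n} (\<lambda>_. density lborel (\<lambda>u. ennreal (std_normal_density u)))) (borel_vec n) (vec n)"

lemma space_borel_vec [simp]: "space (borel_vec n) = carrier_vec n"
  by (simp add: borel_vec_def)

lemma measurable_vec [measurable]: "vec n \<in> PiM {..<n} (\<lambda>_. borel) \<rightarrow>\<^sub>M borel_vec n"
  unfolding borel_vec_def
proof (rule measurable_vimage_algebra2)
  have "(\<lambda>f. \<lambda>i\<in>{..<n}. vec n f $ i) = (\<lambda>f. \<lambda>i\<in>{..<n}. f i :: real)"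
    by (intro ext) (simp add: restrict_def)
  moreover have "(\<lambda>f. \<lambda>i\<in>{..<n}. f i) \<in>
      PiM {..<n} (\<lambda>_. borel) \<rightarrow>\<^sub>M PiM {..<n} (\<lambda>_. borel :: real measure)"
    by (intro measurable_restrict measurable_component_singleton) auto
  ultimately show "(\<lambda>f. \<lambda>i\<in>{..<n}. vec n f $ i) \<in>
      PiM {..<n} (\<lambda>_. borel) \<rightarrow>\<^sub>M PiM {..<n} (\<lambda>_. borel :: real measure)"
    by simp
qed auto

lemma prob_space_std_gaussian_vec: "prob_space (std_gaussian_vec n)"
proof -
  let ?D = "density lborel (\<lambda>u. ennreal (std_normal_density u))"
  interpret D: prob_space ?D
    by (rule prob_space_normal_density) simp
  interpret P: product_prob_space "\<lambda>_. ?D" "{..<n}" ..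
  have "sets (PiM {..<n} (\<lambda>_. ?D)) = sets (PiM {..<n} (\<lambda>_. borel))"
    by (intro sets_PiM_cong) auto
  then have "vec n \<in> PiM {..<n} (\<lambda>_. ?D) \<rightarrow>\<^sub>M borel_vec n"
    using measurable_vec measurable_cong_sets by blast
  then show ?thesis
    unfolding std_gaussian_vec_def by (rule P.prob_space_distr)
qed

definition frobenius_norm :: "real mat \<Rightarrow> real" where
  "frobenius_norm B = sqrt (\<Sum>i<dim_row B. \<Sum>j<dim_col B. \<bar>B $$ (i, j)\<bar>\<^sup>2)"

text \<open>Only meaningful for invertible matrices; otherwise the value is unspecified.\<close>

abbreviation inverse_mat :: "real mat \<Rightarrow> real mat" where
  "inverse_mat S \<equiv> the (mat_inverse S)"

definition ols_estimator :: "real mat \<Rightarrow> real mat \<Rightarrow> real mat" where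
  "ols_estimator Xp Xm = Xp * mat_adjoint Xm * inverse_mat (Xm * mat_adjoint Xm)"

text \<open>The canonical basis is numbered from 1, whereas \<^const>\<open>unit_vec\<close> counts from 0.\<close>

abbreviation canonical_vec :: "nat \<Rightarrow> nat \<Rightarrow> complex vec" where
  "canonical_vec d j \<equiv> unit_vec d (j - 1)"

abbreviation complex_vec :: "real vec \<Rightarrow> complex vec" where
  "complex_vec \<equiv> map_vec complex_of_real"

definition ols_coeff_vec :: "nat \<Rightarrow> real mat \<Rightarrow> nat \<Rightarrow> complex vec" where
  "ols_coeff_vec n Xm k =
     map_mat complex_of_real (mat_adjoint Xm * inverse_mat (Xm * mat_adjoint Xm))
       *\<^sub>v canonical_vec n k"

end

theory Submission
  imports Defs
begin

text \<open>
  Stacking the recursion gives \<open>X\<^sub>+ = A X\<^sub>- + W\<close> with noise matrix \<open>W = [w\<^sub>0, \<dots>, w\<^bsub>N-1\<^esub>]\<close>. The matrix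
  \<open>C = X\<^sub>-\<^sup>* (X\<^sub>- X\<^sub>-\<^sup>*)\<^sup>-\<^sup>1\<close>, whose columns are the \<open>c\<^sub>k\<close>, is a right inverse of \<open>X\<^sub>-\<close>; hence the
  estimator \<open>X\<^sub>+ C\<close> equals \<open>A + W C\<close>, and the first claim is the entrywise Frobenius norm of \<open>W C\<close>.
  The second claim is \<open>X\<^sub>- C = 1\<close> read entrywise, with the states written out by the
  variation-of-constants formula.
\<close>

lemma mat_adjoint_carrier: "B \<in> carrier_mat nr nc \<Longrightarrow> mat_adjoint B \<in> carrier_mat nc nr"
  by (auto simp: mat_adjoint_def)

text \<open>The specification of \<open>mat_inverse\<close> speaks of units of the matrix ring; this
  connects it with \<open>invertible_mat\<close>.\<close>

lemma invertible_mat_in_Units: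
  fixes B :: "'a :: semiring_1 mat"
  assumes B: "B \<in> carrier_mat n n" and "invertible_mat B"
  shows "B \<in> Units (ring_mat TYPE('a) n b)"
proof -
  obtain B' where B': "B * B' = 1\<^sub>m n" "B' * B = 1\<^sub>m (dim_row B')"
    using assms unfolding invertible_mat_def inverts_mat_def by auto
  \<comment> \<open>\<open>inverts_mat\<close> says nothing about the shape of the witness
    \<open>B'\<close>. Comparing the widths of both sides, first in \<open>B * B'\<close> and then
    in \<open>B' * B\<close>, forces it to be square of size \<open>n\<close>.\<close>
  have "dim_col B' = n"
    using arg_cong[OF B'(1), of dim_col] by simp
  moreover have "dim_row B' = n"
    using arg_cong[OF B'(2), of dim_col] B by simp
  ultimately have "B' \<in> carrier_mat n n"
    by (rule carrier_matI[rotated])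
  then show ?thesis
    using B B' by (auto simp: Units_def ring_mat_def)
qed

text \<open>On a square matrix \<open>mat_inverse\<close> yields \<open>None\<close> only for
  non-units, so here \<open>the\<close> is applied to a genuine \<open>Some\<close> and the
  specification of \<open>mat_inverse\<close> takes effect.\<close>

lemma inverse_mat_right:
  assumes B: "B \<in> carrier_mat n n" and "invertible_mat B"
  shows "B * inverse_mat B = 1\<^sub>m n" "inverse_mat B \<in> carrier_mat n n"
proof -
  have "mat_inverse B \<noteq> None"
    using mat_inverse(1)[OF B, where b = "()"] invertible_mat_in_Units[OF assms, of "()"] by auto
  then have "mat_inverse B = Some (inverse_mat B)"
    by auto
  from mat_inverse(2)[OF B this]
  show "B * inverse_mat B = 1\<^sub>m n" "inverse_mat B \<in> carrier_mat n n"
    by auto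
qed

text \<open>\<open>pow_mat\<close> appends its factors on the right, while the recursion multiplies
  the state by \<open>A\<close> from the left.\<close>

lemma pow_mat_Suc_left:
  assumes A: "(A :: 'a :: semiring_1 mat) \<in> carrier_mat n n"
  shows "A ^\<^sub>m Suc k = A * A ^\<^sub>m k"
proof (induction k)
  case 0
  then show ?case using A by simp
next
  case (Suc k)
  have "A ^\<^sub>m Suc (Suc k) = A * A ^\<^sub>m k * A"
    using Suc by simp
  also have "\<dots> = A * (A ^\<^sub>m k * A)"
    by (rule assoc_mult_mat) (use A in auto)
  finally show ?case by simp
qed

text \<open>Variation of constants: the noise \<open>w (t - 1)\<close> enters the state at time
  \<open>t\<close> and is then propagated \<open>s - t\<close> times. Stating this by coordinates
  keeps the sum one of scalars. Membership in the carrier goes through the same induction because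
  the step needs the dimension of \<open>x s\<close>.\<close>

lemma linear_recursion_solution:
  fixes A :: "'a :: comm_ring_1 mat"
  assumes A: "A \<in> carrier_mat n n"
    and w: "\<And>t. t < N \<Longrightarrow> w t \<in> carrier_vec n"
    and x0: "x 0 = 0\<^sub>v n"
    and step: "\<And>t. t < N \<Longrightarrow> x (Suc t) = A *\<^sub>v x t + w t"
  shows "s \<le> N \<Longrightarrow> x s \<in> carrier_vec n \<and>
    (\<forall>j<n. x s $ j = (\<Sum>t=1..s. (A ^\<^sub>m (s - t) *\<^sub>v w (t - 1)) $ j))"
proof (induction s)
  case 0
  then show ?case by (simp add: x0)
next
  case (Suc s)
  then have xs: "x s \<in> carrier_vec n"
    and IH: "\<And>j. j < n \<Longrightarrow> x s $ j = (\<Sum>t=1..s. (A ^\<^sub>m (s - t) *\<^sub>v w (t - 1)) $ j)"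
    and ws: "w s \<in> carrier_vec n"
    using w by auto
  \<comment> \<open>Advancing time by one raises the exponent of every old noise term by one. The
    bound \<open>t \<le> s\<close> makes the truncated subtraction commute with
    \<open>Suc\<close>.\<close>
  have shift: "A *\<^sub>v (A ^\<^sub>m (s - t) *\<^sub>v w (t - 1)) = A ^\<^sub>m (Suc s - t) *\<^sub>v w (t - 1)"
    if "t \<in> {1..s}" for t
  proof -
    have "w (t - 1) \<in> carrier_vec n"
      using that Suc.prems by (intro w) auto
    then have "A *\<^sub>v (A ^\<^sub>m (s - t) *\<^sub>v w (t - 1)) = (A * A ^\<^sub>m (s - t)) *\<^sub>v w (t - 1)"
      using A by (intro assoc_mult_mat_vec[symmetric, where n\<^sub>2 = n]) auto
    also have "A * A ^\<^sub>m (s - t) = A ^\<^sub>m (Suc s - t)"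
      using that by (simp add: Suc_diff_le pow_mat_Suc_left[OF A, symmetric] del: pow_mat.simps)
    finally show ?thesis .
  qed
  have "x (Suc s) $ j = (\<Sum>t=1..Suc s. (A ^\<^sub>m (Suc s - t) *\<^sub>v w (t - 1)) $ j)" if j: "j < n" for j
  proof -
    have "(A *\<^sub>v x s) $ j = (\<Sum>l<n. A $$ (j, l) * x s $ l)"
      using A xs j by (simp add: scalar_prod_def atLeast0LessThan)
    also have "\<dots> = (\<Sum>l<n. A $$ (j, l) * (\<Sum>t=1..s. (A ^\<^sub>m (s - t) *\<^sub>v w (t - 1)) $ l))"
      by (intro sum.cong refl) (simp add: IH)
    also have "\<dots> = (\<Sum>l<n. \<Sum>t=1..s. A $$ (j, l) * (A ^\<^sub>m (s - t) *\<^sub>v w (t - 1)) $ l)"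
      by (simp only: sum_distrib_left)
    also have "\<dots> = (\<Sum>t=1..s. \<Sum>l<n. A $$ (j, l) * (A ^\<^sub>m (s - t) *\<^sub>v w (t - 1)) $ l)"
      by (rule sum.swap)
    also have "\<dots> = (\<Sum>t=1..s. (A *\<^sub>v (A ^\<^sub>m (s - t) *\<^sub>v w (t - 1))) $ j)"
      using A j by (intro sum.cong refl)
        (simp add: scalar_prod_def[of "row A j"] atLeast0LessThan del: index_mult_mat_vec(1)
          add: index_mult_mat_vec(1)[of j A])
    also have "\<dots> = (\<Sum>t=1..s. (A ^\<^sub>m (Suc s - t) *\<^sub>v w (t - 1)) $ j)"
      by (intro sum.cong refl) (simp only: shift)
    \<comment> \<open>The remaining summand \<open>t = Suc s\<close> carries the power
      \<open>A ^\<^sub>m 0\<close>, so it is exactly the fresh noise \<open>w s\<close>.\<close>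
    finally show ?thesis
      using A xs ws j Suc.prems by (simp add: step del: index_mult_mat_vec(1))
  qed
  moreover have "x (Suc s) \<in> carrier_vec n"
    using A xs ws Suc.prems by (simp add: step)
  ultimately show ?case by blast
qed

text \<open>The product \<open>\<bullet>c\<close> conjugates its second argument, which is harmless
  because unit vectors are real. The lemma also translates numbering from 1 into indices from
  0.\<close>

lemma cscalar_prod_canonical_vec:
  "j \<in> {1..d} \<Longrightarrow> v \<in> carrier_vec d \<Longrightarrow> v \<bullet>c canonical_vec d j = v $ (j - 1)"
proof -
  assume j: "j \<in> {1..d}" and v: "v \<in> carrier_vec d"
  have "conjugate (canonical_vec d j) = canonical_vec d j"
    by (rule eq_vecI) (auto simp: unit_vec_def)
  moreover have "j - 1 < d"
    using j by auto
  ultimately show ?thesis by simp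
qed

text \<open>Multiplying by a unit vector selects a column. Invertibility supplies the dimensions of
  \<open>inverse_mat\<close>, whose value is otherwise unspecified.\<close>

lemma ols_coeff_vec_index:
  assumes Xm: "Xm \<in> carrier_mat n N"
    and inv: "invertible_mat (Xm * mat_adjoint Xm)" and k: "k \<in> {1..n}"
  shows "ols_coeff_vec n Xm k \<in> carrier_vec N"
    and "i < N \<Longrightarrow> ols_coeff_vec n Xm k $ i =
      complex_of_real ((mat_adjoint Xm * inverse_mat (Xm * mat_adjoint Xm)) $$ (i, k - 1))"
proof -
  have "Xm * mat_adjoint Xm \<in> carrier_mat n n"
    using Xm mat_adjoint_carrier[OF Xm] by simp
  note G = inverse_mat_right(2)[OF this inv]
  then show "ols_coeff_vec n Xm k \<in> carrier_vec N"
    using carrier_matD[OF mat_adjoint_carrier[OF Xm]]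
    by (intro carrier_vecI) (simp add: ols_coeff_vec_def)
  have "k - 1 < n"
    using k by auto
  then show "i < N \<Longrightarrow> ols_coeff_vec n Xm k $ i =
      complex_of_real ((mat_adjoint Xm * inverse_mat (Xm * mat_adjoint Xm)) $$ (i, k - 1))"
    using G mat_adjoint_carrier[OF Xm]
    by (simp add: ols_coeff_vec_def del: index_mult_mat(1))
qed

theorem corollary3:
  fixes M :: "'a measure"
    and n N :: nat
    and A Xm Xp Ahat :: "real mat"
    and w x :: "nat \<Rightarrow> 'a \<Rightarrow> real vec"
    and c :: "nat \<Rightarrow> complex vec"
    and \<omega> :: 'a
  assumes "prob_space M"
    and "A \<in> carrier_mat n n"
    and "prob_space.indep_vars M (\<lambda>_. borel_vec n) w {..<N}"
    and "\<And>t. t < N \<Longrightarrow> distr M (borel_vec n) (w t) = std_gaussian_vec n"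
    and "\<And>\<omega>'. \<omega>' \<in> space M \<Longrightarrow> x 0 \<omega>' = 0\<^sub>v n"
    and "\<And>t \<omega>'. t < N \<Longrightarrow> \<omega>' \<in> space M \<Longrightarrow> x (Suc t) \<omega>' = A *\<^sub>v x t \<omega>' + w t \<omega>'"
    and "\<omega> \<in> space M"
    and "Xm = mat_of_cols n (map (\<lambda>t. x t \<omega>) [0..<N])"
    and "Xp = mat_of_cols n (map (\<lambda>t. x t \<omega>) [1..<N + 1])"
    and "invertible_mat (Xm * mat_adjoint Xm)"
    and "Ahat = ols_estimator Xp Xm"
    and "\<And>k. k \<in> {1..n} \<Longrightarrow> c k = ols_coeff_vec n Xm k"
  shows "frobenius_norm (A - Ahat) =
      sqrt (\<Sum>j=1..n. \<Sum>k=1..n.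
        (cmod (\<Sum>i=1..N. (complex_vec (w (i - 1) \<omega>) \<bullet>c canonical_vec n j)
                          * (c k \<bullet>c canonical_vec N i)))\<^sup>2)
    \<and> (\<forall>k\<in>{1..n}. c k \<in> carrier_vec N \<and> (\<forall>j\<in>{1..n}.
        (\<Sum>i=1..N. (\<Sum>t=1..i - 1. complex_vec ((A ^\<^sub>m (i - 1 - t)) *\<^sub>v w (t - 1) \<omega>) \<bullet>c canonical_vec n j)
                    * (c k \<bullet>c canonical_vec N i))
        = (if j = k then 1 else 0)))"
proof -
  interpret prob_space M by fact
  note A = \<open>A \<in> carrier_mat n n\<close>
  define C where "C = mat_adjoint Xm * inverse_mat (Xm * mat_adjoint Xm)"
  define W where "W = mat_of_cols n (map (\<lambda>t. w t \<omega>) [0..<N])"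
  \<comment> \<open>Measurability, contained in \<open>indep_vars\<close>, places every value of
    \<open>w t\<close> in the space of \<open>borel_vec n\<close>, which is
    \<open>carrier_vec n\<close>.\<close>
  have w: "w t \<omega> \<in> carrier_vec n" if "t < N" for t
  proof -
    have "w t \<in> measurable M (borel_vec n)"
      using assms(3) that unfolding indep_vars_def by auto
    from measurable_space[OF this \<open>\<omega> \<in> space M\<close>] show ?thesis by simp
  qed
  note solution = linear_recursion_solution[where N = N and x = "\<lambda>t. x t \<omega>" and w = "\<lambda>t. w t \<omega>",
      OF A w assms(5)[OF assms(7)] assms(6)[OF _ assms(7)]]
  have x: "x t \<omega> \<in> carrier_vec n" if "t \<le> N" for t
    using solution[of t] that by simp
  have Xm: "Xm \<in> carrier_mat n N" and W: "W \<in> carrier_mat n N"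
    by (auto simp: assms(8) W_def)
  note Xma = mat_adjoint_carrier[OF Xm]
  have G: "Xm * mat_adjoint Xm \<in> carrier_mat n n"
    using Xm Xma by simp
  note inv = inverse_mat_right[OF G assms(10)]
  have C: "C \<in> carrier_mat N n"
    using Xma inv(2) by (auto simp: C_def)
  have XmC: "Xm * C = 1\<^sub>m n"
    unfolding C_def using inv assoc_mult_mat[OF Xm Xma inv(2)] by simp
  \<comment> \<open>The list defining \<open>Xp\<close> starts at 1, so its column \<open>j\<close>
    is \<open>x (Suc j) \<omega>\<close> and each entry of the identity is the recursion at time
    \<open>j\<close>.\<close>
  have Xp: "Xp = A * Xm + W"
  proof (rule eq_matI)
    fix i j assume "i < dim_row (A * Xm + W)" "j < dim_col (A * Xm + W)"
    then have i: "i < n" and j: "j < N"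
      using W by auto
    have "col Xm j = x j \<omega>"
      using j x[of j] by (simp add: assms(8))
    then show "Xp $$ (i, j) = (A * Xm + W) $$ (i, j)"
      using i j A Xm W w[of j] x[of j] assms(6)[OF j assms(7)]
      by (simp add: assms(9) W_def mat_of_cols_index del: upt_Suc)
  qed (use W in \<open>auto simp: assms(9)\<close>)
  have "Ahat = Xp * C"
    unfolding assms(11) ols_estimator_def C_def
    by (rule assoc_mult_mat[OF _ Xma inv(2), of _ n]) (auto simp: assms(9) intro!: carrier_matI)
  also have "\<dots> = A * Xm * C + W * C"
    unfolding Xp by (rule add_mult_distrib_mat) (use A Xm W C in auto)
  also have "A * Xm * C = A"
    using assoc_mult_mat[OF A Xm C] XmC A by simp
  finally have Ahat: "Ahat = A + W * C" .
  have W_index: "(W * C) $$ (j, k) = (\<Sum>i<N. w i \<omega> $ j * C $$ (i, k))"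
    if "j < n" "k < n" for j k
    using that W C by (simp add: scalar_prod_def W_def mat_of_cols_index atLeast0LessThan)
  have Xm_index: "(Xm * C) $$ (j, k) = (\<Sum>i<N. x i \<omega> $ j * C $$ (i, k))"
    if "j < n" "k < n" for j k
    using that Xm C by (simp add: scalar_prod_def assms(8) mat_of_cols_index atLeast0LessThan)
  have c: "c k \<in> carrier_vec N" if "k \<in> {1..n}" for k
    using ols_coeff_vec_index(1)[OF Xm assms(10) that] assms(12)[OF that] by simp
  have c_index: "c k \<bullet>c canonical_vec N i = complex_of_real (C $$ (i - 1, k - 1))"
    if "k \<in> {1..n}" "i \<in> {1..N}" for k i
  proof -
    have "c k \<bullet>c canonical_vec N i = c k $ (i - 1)"
      using that c by (intro cscalar_prod_canonical_vec) auto
    moreover have "i - 1 < N"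
      using that by auto
    ultimately show ?thesis
      using ols_coeff_vec_index(2)[OF Xm assms(10) that(1), of "i - 1"] assms(12)[OF that(1)]
      by (simp add: C_def)
  qed
  \<comment> \<open>Both inner products are embedded real numbers, hence so is the sum, and the
    squared \<open>cmod\<close> of the claim becomes the square of a real matrix entry.\<close>
  have WC: "(\<Sum>i=1..N. (complex_vec (w (i - 1) \<omega>) \<bullet>c canonical_vec n j)
      * (c k \<bullet>c canonical_vec N i)) = complex_of_real ((W * C) $$ (j - 1, k - 1))"
    if j: "j \<in> {1..n}" and k: "k \<in> {1..n}" for j k
  proof -
    have "(\<Sum>i=1..N. (complex_vec (w (i - 1) \<omega>) \<bullet>c canonical_vec n j)
        * (c k \<bullet>c canonical_vec N i))
      = (\<Sum>i=1..N. complex_of_real (w (i - 1) \<omega> $ (j - 1) * C $$ (i - 1, k - 1)))"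
    proof (rule sum.cong[OF refl])
      fix i assume i: "i \<in> {1..N}"
      have wi: "w (i - 1) \<omega> \<in> carrier_vec n"
        using i by (intro w) auto
      have "complex_vec (w (i - 1) \<omega>) \<bullet>c canonical_vec n j = complex_of_real (w (i - 1) \<omega> $ (j - 1))"
        using wi j by (subst cscalar_prod_canonical_vec[OF j]) auto
      then show "(complex_vec (w (i - 1) \<omega>) \<bullet>c canonical_vec n j) * (c k \<bullet>c canonical_vec N i)
          = complex_of_real (w (i - 1) \<omega> $ (j - 1) * C $$ (i - 1, k - 1))"
        by (simp only: c_index[OF k i] of_real_mult)
    qed
    also have "\<dots> = complex_of_real (\<Sum>i<N. w i \<omega> $ (j - 1) * C $$ (i, k - 1))"
      by (simp add: sum.atLeast1_atMost_eq)
    also have "\<dots> = complex_of_real ((W * C) $$ (j - 1, k - 1))"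
      using j k by (subst W_index) auto
    finally show ?thesis .
  qed
  \<comment> \<open>The error \<open>A - Ahat\<close> is the negative of \<open>W * C\<close>; the
    sign disappears under the square.\<close>
  have "frobenius_norm (A - Ahat) = sqrt (\<Sum>j<n. \<Sum>k<n. ((W * C) $$ (j, k))\<^sup>2)"
    using A W C by (simp add: frobenius_norm_def Ahat del: index_mult_mat(1))
  also have "(\<Sum>j<n. \<Sum>k<n. ((W * C) $$ (j, k))\<^sup>2)
      = (\<Sum>j=1..n. \<Sum>k=1..n. ((W * C) $$ (j - 1, k - 1))\<^sup>2)"
    by (simp add: sum.atLeast1_atMost_eq del: index_mult_mat(1))
  also have "\<dots> = (\<Sum>j=1..n. \<Sum>k=1..n.
      (cmod (\<Sum>i=1..N. (complex_vec (w (i - 1) \<omega>) \<bullet>c canonical_vec n j)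
        * (c k \<bullet>c canonical_vec N i)))\<^sup>2)"
    by (intro sum.cong refl) (simp only: WC norm_of_real power2_abs)
  finally have norm: "frobenius_norm (A - Ahat) = sqrt \<dots>" .
  have right_inverse: "(\<Sum>i=1..N. (\<Sum>t=1..i - 1.
        complex_vec ((A ^\<^sub>m (i - 1 - t)) *\<^sub>v w (t - 1) \<omega>) \<bullet>c canonical_vec n j)
        * (c k \<bullet>c canonical_vec N i)) = (if j = k then 1 else 0)"
    if k: "k \<in> {1..n}" and j: "j \<in> {1..n}" for j k
  proof -
    have "(\<Sum>i=1..N. (\<Sum>t=1..i - 1.
        complex_vec ((A ^\<^sub>m (i - 1 - t)) *\<^sub>v w (t - 1) \<omega>) \<bullet>c canonical_vec n j)
        * (c k \<bullet>c canonical_vec N i))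
      = (\<Sum>i=1..N. complex_of_real (x (i - 1) \<omega> $ (j - 1) * C $$ (i - 1, k - 1)))"
    proof (rule sum.cong[OF refl])
      fix i assume i: "i \<in> {1..N}"
      \<comment> \<open>This holds for arbitrary \<open>v\<close>, since the dimension of the
        product is the number of rows of the matrix; no range for \<open>t\<close> has to be tracked
        below.\<close>
      have carr: "A ^\<^sub>m s *\<^sub>v v \<in> carrier_vec n" for s v
        using A by (intro carrier_vecI) simp
      have "(\<Sum>t=1..i - 1.
          complex_vec ((A ^\<^sub>m (i - 1 - t)) *\<^sub>v w (t - 1) \<omega>) \<bullet>c canonical_vec n j)
        = (\<Sum>t=1..i - 1. complex_of_real (((A ^\<^sub>m (i - 1 - t)) *\<^sub>v w (t - 1) \<omega>) $ (j - 1)))"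
      proof (rule sum.cong[OF refl])
        fix t
        let ?v = "(A ^\<^sub>m (i - 1 - t)) *\<^sub>v w (t - 1) \<omega>"
        have "complex_vec ?v \<bullet>c canonical_vec n j = complex_vec ?v $ (j - 1)"
          by (rule cscalar_prod_canonical_vec[OF j]) (simp only: map_carrier_vec carr)
        also have "\<dots> = complex_of_real (?v $ (j - 1))"
          by (rule index_map_vec(1)) (use j carrier_vecD[OF carr] in auto)
        finally show "complex_vec ?v \<bullet>c canonical_vec n j = complex_of_real (?v $ (j - 1))" .
      qed
      \<comment> \<open>The inner sum is the state at time \<open>i - 1\<close>, that is, an entry
        of column \<open>i - 1\<close> of \<open>Xm\<close>. For \<open>i = 1\<close> the sum is
        empty, in agreement with the zero initial state.\<close>
      also have "\<dots> = complex_of_real (x (i - 1) \<omega> $ (j - 1))"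
      proof -
        have "i - 1 \<le> N" "j - 1 < n"
          using i j by auto
        with solution[of "i - 1"]
        have "x (i - 1) \<omega> $ (j - 1)
          = (\<Sum>t=1..i - 1. (A ^\<^sub>m (i - 1 - t) *\<^sub>v w (t - 1) \<omega>) $ (j - 1))"
          by blast
        then show ?thesis
          by (simp only: of_real_sum)
      qed
      finally show "(\<Sum>t=1..i - 1.
          complex_vec ((A ^\<^sub>m (i - 1 - t)) *\<^sub>v w (t - 1) \<omega>) \<bullet>c canonical_vec n j)
          * (c k \<bullet>c canonical_vec N i)
        = complex_of_real (x (i - 1) \<omega> $ (j - 1) * C $$ (i - 1, k - 1))"
        by (simp only: c_index[OF k i] of_real_mult)
    qed
    also have "\<dots> = complex_of_real (\<Sum>i<N. x i \<omega> $ (j - 1) * C $$ (i, k - 1))"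
      by (simp add: sum.atLeast1_atMost_eq)
    also have "\<dots> = complex_of_real ((Xm * C) $$ (j - 1, k - 1))"
      using j k by (subst Xm_index) auto
    \<comment> \<open>As \<open>j\<close> and \<open>k\<close> are at least 1, truncated subtraction
      is injective on them: \<open>j - 1 = k - 1\<close> only if \<open>j = k\<close>.\<close>
    also have "\<dots> = (if j = k then 1 else 0)"
      using j k by (auto simp: XmC)
    finally show ?thesis .
  qed
  show ?thesis
    by (intro conjI ballI norm c right_inverse)
qed

end
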